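(* Let $X$ be a compact metric space and let $G$ be a closed relation on $X$. If a Cantor set is finitely generated by $G$, then at least two periodic points are generated by $G$.
   Context: A closed relation on a compact metric space $X$ is a closed subset $G\subseteq X\times X$. The infinite Mahavier product is $\star_{n=1}^{\infty}G^{-1}=\{(x_1,x_2,\dots)\in\prod_{i=1}^\infty X : (x_{i+1},x_i)\in G\text{ for all }i\ge1\}$ (with the subspace topology of the product topology). The shift map $\sigma$ on it is $\sigma(x_1,x_2,x_3,\dots)=(x_2,x_3,\dots)$. A periodic point generated by $G$ is a point $\mathbf x\in\star_{n=1}^{\infty}G^{-1}$ with $\sigma^n(\mathbf x)=\mathbf x$ for some positive integer $n$. A subspace $A$ of $\star_{n=1}^{\infty}G^{-1}$ is finitely generated by $G$ if there is a finite set $F\subseteq G$ with $\star_{n=1}^{\infty}F^{-1}=A$. A compact metric space $Y$ is finitely generated by $G$ if some subspace $A$ of $\star_{n=1}^{\infty}G^{-1}$ is homeomorphic to $Y$ and finitely generated by $G$. A Cantor set is a space homeomorphic to the standard Cantor set. *)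

theory Defs
  imports "HOL-Analysis.Analysis"
begin

text \<open>
  A compact metric space is represented by a compact set \<open>X\<close> of a type of class
  \<open>metric_space\<close>. Sequences are functions on \<open>nat\<close>, so the paper's \<open>x\<^sub>1, x\<^sub>2, \<dots>\<close> are
  \<open>x 0, x 1, \<dots>\<close>, and sets of sequences carry the subspace topology of the product
  topology that the library puts on the function type.
\<close>

definition closed_relation :: "'a::metric_space set \<Rightarrow> ('a \<times> 'a) set \<Rightarrow> bool" where
  "closed_relation X G \<longleftrightarrow> closedin (top_of_set (X \<times> X)) G"

text \<open>
  The Mahavier product of infinitely many copies of \<open>H\<close>. It is used below with the inverse
  relation \<open>H = G\<inverse>\<close>, where the condition reads \<open>(x (Suc i), x i) \<in> G\<close>.
\<close>

definition mahavier_product :: "'a set \<Rightarrow> ('a \<times> 'a) set \<Rightarrow> (nat \<Rightarrow> 'a) set" where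
  "mahavier_product X H = {x. (\<forall>i. x i \<in> X) \<and> (\<forall>i. (x i, x (Suc i)) \<in> H)}"

definition shift_map :: "(nat \<Rightarrow> 'a) \<Rightarrow> nat \<Rightarrow> 'a" where
  "shift_map x = (\<lambda>i. x (Suc i))"

definition periodic_point_generated_by ::
    "'a set \<Rightarrow> ('a \<times> 'a) set \<Rightarrow> (nat \<Rightarrow> 'a) \<Rightarrow> bool" where
  "periodic_point_generated_by X G x \<longleftrightarrow>
     x \<in> mahavier_product X (G\<inverse>) \<and> (\<exists>n>0. (shift_map ^^ n) x = x)"

definition subspace_finitely_generated_by ::
    "'a set \<Rightarrow> ('a \<times> 'a) set \<Rightarrow> (nat \<Rightarrow> 'a) set \<Rightarrow> bool" where
  "subspace_finitely_generated_by X G A \<longleftrightarrow>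
     A \<subseteq> mahavier_product X (G\<inverse>) \<and>
     (\<exists>F. finite F \<and> F \<subseteq> G \<and> mahavier_product X (F\<inverse>) = A)"

definition space_finitely_generated_by ::
    "'a::metric_space set \<Rightarrow> ('a \<times> 'a) set \<Rightarrow> 'b::metric_space set \<Rightarrow> bool" where
  "space_finitely_generated_by X G Y \<longleftrightarrow>
     (\<exists>A. A \<subseteq> mahavier_product X (G\<inverse>) \<and> A homeomorphic Y \<and>
          subspace_finitely_generated_by X G A)"

text \<open>The stages of the middle-third construction of the standard Cantor set.\<close>

primrec cantor_stage :: "nat \<Rightarrow> real set" where
  "cantor_stage 0 = {0..1}"
| "cantor_stage (Suc n) =
     (\<lambda>t. t / 3) ` cantor_stage n \<union> (\<lambda>t. 2 / 3 + t / 3) ` cantor_stage n"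

definition standard_cantor_set :: "real set" where
  "standard_cantor_set = (\<Inter>n. cantor_stage n)"

definition cantor_set :: "'b::topological_space set \<Rightarrow> bool" where
  "cantor_set Y \<longleftrightarrow> Y homeomorphic standard_cantor_set"

end

theory Submission
  imports Defs
begin

text \<open>
  The contradiction comes from the infinitude of a Cantor set. Let the finite relation \<open>F\<close>
  generate a copy of it, and read \<open>F\<inverse>\<close> as a finite directed graph, so that the points of the
  Mahavier product are the infinite walks. A walk that meets a vertex twice can be made to run
  round the loop in between forever, which is a periodic point (\<open>periodic_point_of_loop\<close>).

  Suppose there is at most one periodic point. The shift of a periodic point is again periodic, so
  the periodic point is fixed by the shift: it is a constant walk at a vertex \<open>v\<close>. Hence every loop
  consists of \<open>v\<close> alone. An infinite walk in a finite graph must return to some vertex infinitely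
  often, so every walk ends up at \<open>v\<close>, and it stays there from its first visit on. Before
  that visit no vertex repeats, so the visit happens within as many steps as there are vertices.
  Only finitely many walks of this kind exist (\<open>finite_mahavier_product\<close>), and no Cantor set is
  homeomorphic to a finite space.
\<close>

lemma shift_map_funpow: "(shift_map ^^ n) x = (\<lambda>i. x (i + n))"
  by (induction n) (simp_all add: shift_map_def)

lemma shift_map_mahavier_product:
  "x \<in> mahavier_product X H \<Longrightarrow> shift_map x \<in> mahavier_product X H"
  by (simp add: mahavier_product_def shift_map_def)

lemma periodic_point_shift_map:
  assumes "periodic_point_generated_by X G x"
  shows "periodic_point_generated_by X G (shift_map x)"
proof -
  obtain n where "n > 0" "(shift_map ^^ n) x = x"
    using assms unfolding periodic_point_generated_by_def by blast
  then have "(shift_map ^^ n) (shift_map x) = shift_map x" by (metis funpow_swap1)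
  then show ?thesis
    using assms shift_map_mahavier_product \<open>n > 0\<close>
    unfolding periodic_point_generated_by_def by blast
qed

lemma periodic_point_mono:
  assumes "periodic_point_generated_by X F x" and "F \<subseteq> G"
  shows "periodic_point_generated_by X G x"
proof -
  have "mahavier_product X (F\<inverse>) \<subseteq> mahavier_product X (G\<inverse>)"
    using \<open>F \<subseteq> G\<close> by (auto simp: mahavier_product_def)
  then show ?thesis using assms(1) unfolding periodic_point_generated_by_def by blast
qed

text \<open>
  The segment of the walk between the two equal entries closes up, so it can be repeated forever.
\<close>

lemma periodic_point_of_loop:
  assumes x: "x \<in> mahavier_product X (G\<inverse>)" and "i < j" and loop: "x i = x j"
  shows "periodic_point_generated_by X G (\<lambda>k. x (i + k mod (j - i)))"
proof -
  let ?y = "\<lambda>k. x (i + k mod (j - i))"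
  have step: "(?y k, ?y (Suc k)) \<in> G\<inverse>" for k
  proof (cases "Suc (k mod (j - i)) = j - i")
    case True
    then have "?y (Suc k) = x i" by (simp add: mod_Suc)
    moreover have "Suc (i + k mod (j - i)) = j" using True \<open>i < j\<close> by simp
    ultimately show ?thesis
      using x loop unfolding mahavier_product_def by (metis (mono_tags, lifting) mem_Collect_eq)
  next
    case False
    then have "?y (Suc k) = x (Suc (i + k mod (j - i)))" by (simp add: mod_Suc)
    then show ?thesis using x unfolding mahavier_product_def by simp
  qed
  then have "?y \<in> mahavier_product X (G\<inverse>)"
    using x unfolding mahavier_product_def by auto
  moreover have "(shift_map ^^ (j - i)) ?y = ?y"
    by (simp add: shift_map_funpow)
  ultimately show ?thesis
    unfolding periodic_point_generated_by_def using \<open>i < j\<close> by (metis zero_less_diff)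
qed

text \<open>
  Comparing any loop with the constant periodic point shows that walks repeat no vertex other than
  one fixed \<open>v\<close>. Recurrence then turns every visit to \<open>v\<close> into a permanent stay, and the pigeonhole
  principle bounds the time before that visit uniformly over all walks. This uniform bound gives
  finiteness, where eventual constancy alone would only give countability.
\<close>

theorem finite_mahavier_product:
  assumes "finite F"
    and unique: "\<And>x y. periodic_point_generated_by X F x \<Longrightarrow> periodic_point_generated_by X F y
                   \<Longrightarrow> x = y"
  shows "finite (mahavier_product X (F\<inverse>))"
proof (cases "mahavier_product X (F\<inverse>) = {}")
  case False
  let ?M = "mahavier_product X (F\<inverse>)"
  define V where "V = snd ` F"
  have "finite V" using \<open>finite F\<close> by (simp add: V_def)
  have range: "x k \<in> V" if "x \<in> ?M" for x k
  proof -
    have "(x (Suc k), x k) \<in> F" using that unfolding mahavier_product_def by auto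
    then show ?thesis unfolding V_def by force
  qed
  have recurrent: "\<exists>w. infinite {k. x k = w}" if "x \<in> ?M" for x
  proof -
    have "finite (x ` UNIV)"
      by (rule finite_subset[OF _ \<open>finite V\<close>]) (use range[OF that] in auto)
    then show ?thesis using pigeonhole_infinite[of UNIV x] by auto
  qed
  have later: "\<exists>l>k. x l = w" if "infinite {k. x k = w}" for x :: "nat \<Rightarrow> 'a" and w k
    using that by (auto simp: infinite_nat_iff_unbounded)
  obtain z where "z \<in> ?M" using False by auto
  then obtain w where w: "infinite {k. z k = w}" using recurrent by blast
  obtain a where "z a = w" using later[OF w] by blast
  moreover obtain b where "a < b" "z b = w" using later[OF w] by blast
  ultimately obtain p where p: "periodic_point_generated_by X F p"
    using periodic_point_of_loop[OF \<open>z \<in> ?M\<close>, of a b] by auto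
  define v where "v = p 0"
  have "shift_map p = p" using unique periodic_point_shift_map p by blast
  then have "p (Suc k) = p k" for k
    unfolding shift_map_def by (rule fun_cong)
  then have p_const: "p k = v" for k unfolding v_def by (induction k) auto
  have loop_v: "x k = v" if "x \<in> ?M" "x i = x j" "i \<le> k" "k < j" for x i j k
  proof -
    have "(\<lambda>k. x (i + k mod (j - i))) = p"
      using unique p periodic_point_of_loop[of x X F i j] that by simp
    then have "x (i + (k - i) mod (j - i)) = v" using p_const by metis
    then show ?thesis using that by simp
  qed
  \<comment> \<open>A vertex visited infinitely often is on a loop, so it is \<open>v\<close>; thus a walk that has reached \<open>v\<close>
    is always between two visits to \<open>v\<close>.\<close>
  have stays: "x l = v" if x: "x \<in> ?M" and "x k = v" "k \<le> l" for x k l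
  proof -
    obtain w where w: "infinite {k. x k = w}" using recurrent x by blast
    obtain a where "x a = w" using later[OF w] by blast
    moreover obtain b where "a < b" "x b = w" using later[OF w] by blast
    ultimately have "w = v" using loop_v[OF x, of a b a] by simp
    then obtain c where "l < c" "x c = v" using later[OF w] by blast
    then show ?thesis using loop_v[OF x, of k c l] that by simp
  qed
  have ends: "x k = v" if x: "x \<in> ?M" and k: "card V \<le> k" for x k
  proof (rule ccontr)
    assume neq: "x k \<noteq> v"
    have "inj_on x {..k}"
    proof (rule linorder_inj_onI)
      fix i j assume "i < j" "i \<in> {..k}" "j \<in> {..k}"
      then show "x i \<noteq> x j"
        using loop_v[OF x, of i j i] stays[OF x, of i k] neq by auto
    qed auto
    moreover have "x ` {..k} \<subseteq> V" using range[OF x] by blast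
    ultimately have "card {..k} \<le> card V" using card_inj_on_le \<open>finite V\<close> by blast
    then show False using k by simp
  qed
  have "?M \<subseteq> {x. \<forall>k. (k \<in> {..<card V} \<longrightarrow> x k \<in> V) \<and> (k \<notin> {..<card V} \<longrightarrow> x k = v)}"
    using range ends by auto
  then show ?thesis
    using finite_set_of_finite_funs[of "{..<card V}" V v] \<open>finite V\<close> finite_subset by blast
qed simp

text \<open>
  The powers of \<open>1 / 3\<close> stay in every stage, because the left contraction \<open>t \<mapsto> t / 3\<close> takes each
  of them to the next; \<open>1\<close> itself is fixed by the right contraction.
\<close>

lemma power_third_in_cantor_stage: "(1 / 3) ^ n \<in> cantor_stage m"
proof (induction m arbitrary: n)
  case 0
  then show ?case by (simp add: power_le_one)
next
  case (Suc m)
  show ?case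
  proof (cases n)
    case 0
    have "2 / 3 + (1 / 3) ^ 0 / 3 \<in> cantor_stage (Suc m)"
      unfolding cantor_stage.simps by (intro UnI2 imageI Suc.IH)
    then show ?thesis using 0 by simp
  next
    case (Suc l)
    have "(1 / 3) ^ l / 3 \<in> cantor_stage (Suc m)"
      unfolding cantor_stage.simps by (intro UnI1 imageI Suc.IH)
    then show ?thesis using Suc by simp
  qed
qed

lemma infinite_standard_cantor_set: "infinite standard_cantor_set"
proof -
  have "inj (\<lambda>n. (1 / 3 :: real) ^ n)"
  proof (rule linorder_injI)
    fix m n :: nat assume "m < n"
    then have "(1 / 3 :: real) ^ n < (1 / 3) ^ m" by (rule power_strict_decreasing) auto
    then show "(1 / 3 :: real) ^ m \<noteq> (1 / 3) ^ n" by (rule less_imp_neq[symmetric])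
  qed
  then have "infinite (range (\<lambda>n. (1 / 3 :: real) ^ n))" by (rule range_inj_infinite)
  moreover have "range (\<lambda>n. (1 / 3) ^ n) \<subseteq> standard_cantor_set"
    using power_third_in_cantor_stage unfolding standard_cantor_set_def by blast
  ultimately show ?thesis using finite_subset by blast
qed

lemma homeomorphic_finite_iff: "S homeomorphic T \<Longrightarrow> finite S \<longleftrightarrow> finite T"
  unfolding homeomorphic_def homeomorphism_def by (metis finite_imageI)

lemma infinite_cantor_set: "cantor_set Y \<Longrightarrow> infinite Y"
  using infinite_standard_cantor_set homeomorphic_finite_iff unfolding cantor_set_def by blast

theorem theorem4p4:
  fixes X :: "'a::metric_space set" and G :: "('a \<times> 'a) set"
    and C :: "'b::metric_space set"
  assumes "compact X" and "closed_relation X G"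
    and "cantor_set C" and "space_finitely_generated_by X G C"
  shows "\<exists>x y. periodic_point_generated_by X G x \<and> periodic_point_generated_by X G y \<and> x \<noteq> y"
proof -
  obtain F where F: "finite F" "F \<subseteq> G" "mahavier_product X (F\<inverse>) homeomorphic C"
    using assms(4)
    unfolding space_finitely_generated_by_def subspace_finitely_generated_by_def by blast
  have "infinite (mahavier_product X (F\<inverse>))"
    using infinite_cantor_set[OF assms(3)] homeomorphic_finite_iff[OF F(3)] by simp
  then obtain x y where "periodic_point_generated_by X F x" "periodic_point_generated_by X F y"
      "x \<noteq> y"
    using finite_mahavier_product[OF F(1), of X] by blast
  then show ?thesis using periodic_point_mono F(2) by blast
qed

end
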